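(* Let $a_1> a_2> \cdots > a_k\geq 1$, and let $G=S_{\left(a_1^{r_1},a_2^{r_2},\ldots,a_k^{r_k}\right)}$. Then $\operatorname{gon}(G)=\min_{0\leq j\leq k}\left\{\sum_{i=1}^j r_i+a_{j+1}\right\}$, where $a_{k+1}$ is taken to be $1$.
   Context: A banana star $S_{\left(a_1^{r_1},\ldots,a_k^{r_k}\right)}$ is a multigraph whose underlying simple graph is a star: a central vertex $v_0$ adjacent to all other vertices (leaves, pairwise non-adjacent), where exactly $r_i$ leaves are joined to $v_0$ by $a_i$ parallel edges. $\operatorname{gon}$ denotes the divisorial gonality, the minimum degree of a divisor of positive rank in the chip-firing (Baker–Norine) divisor theory. *)

theory Defs
  imports Main "HOL-Library.Multiset"
begin

text \<open>A finite loopless multigraph: vertex set \<open>V\<close> and a multiset \<open>E\<close> of unordered pairs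
  of distinct vertices.\<close>

definition multigraph :: "'v set \<Rightarrow> 'v set multiset \<Rightarrow> bool" where
  "multigraph V E \<longleftrightarrow> finite V \<and> V \<noteq> {} \<and> (\<forall>e\<in>#E. e \<subseteq> V \<and> card e = 2)"

text \<open>Divisors are functions \<open>'v \<Rightarrow> int\<close> of which only the values on \<open>V\<close> matter.\<close>

definition div_degree :: "'v set \<Rightarrow> ('v \<Rightarrow> int) \<Rightarrow> int" where
  "div_degree V D = (\<Sum>v\<in>V. D v)"

definition effective :: "'v set \<Rightarrow> ('v \<Rightarrow> int) \<Rightarrow> bool" where
  "effective V D \<longleftrightarrow> (\<forall>v\<in>V. D v \<ge> 0)"

text \<open>Firing each vertex \<open>v\<close> exactly \<open>f v\<close> times removes \<open>laplacian V E f v\<close> chips from \<open>v\<close>.\<close>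

definition laplacian :: "'v set \<Rightarrow> 'v set multiset \<Rightarrow> ('v \<Rightarrow> int) \<Rightarrow> 'v \<Rightarrow> int" where
  "laplacian V E f v = (\<Sum>w\<in>V. int (count E {v, w}) * (f v - f w))"

definition lin_equiv :: "'v set \<Rightarrow> 'v set multiset \<Rightarrow> ('v \<Rightarrow> int) \<Rightarrow> ('v \<Rightarrow> int) \<Rightarrow> bool" where
  "lin_equiv V E D D' \<longleftrightarrow> (\<exists>f. \<forall>v\<in>V. D v - D' v = laplacian V E f v)"

definition linear_system :: "'v set \<Rightarrow> 'v set multiset \<Rightarrow> ('v \<Rightarrow> int) \<Rightarrow> ('v \<Rightarrow> int) set" where
  "linear_system V E D = {D'. effective V D' \<and> lin_equiv V E D D'}"

text \<open>The Baker--Norine rank. The greatest \<open>k\<close> exists because linear equivalence preserves the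
  degree, so that every admissible \<open>k\<close> is at most the degree of \<open>D\<close>.\<close>

definition div_rank :: "'v set \<Rightarrow> 'v set multiset \<Rightarrow> ('v \<Rightarrow> int) \<Rightarrow> int" where
  "div_rank V E D =
    (if linear_system V E D = {} then -1
     else int (GREATEST k::nat. \<forall>F. effective V F \<and> div_degree V F = int k \<longrightarrow>
                 linear_system V E (\<lambda>v. D v - F v) \<noteq> {}))"

text \<open>A divisor of positive rank is equivalent to an effective one, so its degree is a
  natural number.\<close>

definition gonality :: "'v set \<Rightarrow> 'v set multiset \<Rightarrow> nat" where
  "gonality V E = (LEAST d::nat. \<exists>D. div_rank V E D > 0 \<and> div_degree V D = int d)"

definition banana_star ::
  "'v set \<Rightarrow> 'v set multiset \<Rightarrow> nat \<Rightarrow> (nat \<Rightarrow> nat) \<Rightarrow> (nat \<Rightarrow> nat) \<Rightarrow> bool" where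
  "banana_star V E k a r \<longleftrightarrow> multigraph V E \<and>
    (\<exists>v0\<in>V.
      (\<forall>v\<in>V - {v0}. {v0, v} \<in># E) \<and>
      (\<forall>u\<in>V - {v0}. \<forall>v\<in>V - {v0}. {u, v} \<notin># E) \<and>
      (\<forall>v\<in>V - {v0}. \<exists>i\<in>{1..k}. count E {v0, v} = a i) \<and>
      (\<forall>i\<in>{1..k}. card {v\<in>V - {v0}. count E {v0, v} = a i} = r i))"

end

theory Submission
  imports Defs
begin

text \<open>
  On a star, linear equivalence preserves exactly the degree and the residue \<open>\<rho> v\<close> of every
  leaf \<open>v\<close> modulo its multiplicity \<open>c v\<close>. Reducing every leaf to its residue leaves
  \<open>T = deg D - \<Sum> \<rho> v\<close> chips at the centre, and \<open>D\<close> has positive rank iff \<open>T \<ge> 1\<close> and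
  \<open>c v \<le> T\<close> for all leaves with \<open>\<rho> v = 0\<close>. Then every leaf with \<open>c v > T\<close> contributes at least
  one chip, so \<open>deg D \<ge> T + card {v. c v > T}\<close>, and equality is attained for every \<open>T \<ge> 1\<close>.
  Minimising over \<open>T\<close>, it suffices to consider the values \<open>a 1, \<dots>, a k, 1\<close>.
\<close>

section \<open>Degree, linear equivalence and positive rank on arbitrary multigraphs\<close>

text \<open>Edges are unordered, so exchanging the two summations makes what each edge takes from
  one end cancel what it gives to the other.\<close>

lemma sum_laplacian_eq_0: "(\<Sum>v\<in>V. laplacian V E f v) = 0"
proof -
  have "(\<Sum>v\<in>V. \<Sum>w\<in>V. int (count E {v, w}) * f w) = (\<Sum>v\<in>V. \<Sum>w\<in>V. int (count E {v, w}) * f v)"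
    by (subst sum.swap) (simp add: insert_commute)
  then show ?thesis
    by (simp add: laplacian_def right_diff_distrib sum_subtractf)
qed

lemma lin_equiv_degree:
  assumes "lin_equiv V E D D'"
  shows "div_degree V D = div_degree V D'"
proof -
  obtain f where "\<forall>v\<in>V. D v - D' v = laplacian V E f v"
    using assms by (auto simp: lin_equiv_def)
  then have "(\<Sum>v\<in>V. D v - D' v) = (\<Sum>v\<in>V. laplacian V E f v)"
    by (intro sum.cong) auto
  then show ?thesis
    by (simp add: sum_laplacian_eq_0 sum_subtractf div_degree_def)
qed

lemma lin_equiv_diff_left_iff:
  "lin_equiv V E (\<lambda>v. D v - F v) D' \<longleftrightarrow> lin_equiv V E D (\<lambda>v. D' v + F v)"
  unfolding lin_equiv_def by (simp add: algebra_simps)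

lemma div_degree_indicator:
  assumes "finite V" "v \<in> V"
  shows "div_degree V (\<lambda>u. if u = v then n else 0) = n"
  using assms by (simp add: div_degree_def)

lemma effective_degree_1_cases:
  assumes "effective V F" "div_degree V F = 1"
  obtains v where "v \<in> V" "F v = 1" "\<And>u. u \<in> V \<Longrightarrow> u \<noteq> v \<Longrightarrow> F u = 0"
proof -
  have fin: "finite V"
    using assms by (metis div_degree_def sum.infinite zero_neq_one)
  obtain v where v: "v \<in> V" "F v \<noteq> 0"
    using assms by (metis div_degree_def sum.neutral zero_neq_one)
  have nn: "F u \<ge> 0" if "u \<in> V" for u
    using assms that by (simp add: effective_def)
  have eq: "F v + (\<Sum>u\<in>V - {v}. F u) = 1"
    using assms v fin by (simp add: div_degree_def sum.remove[of V v])
  have "(\<Sum>u\<in>V - {v}. F u) \<ge> 0"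
    using nn by (intro sum_nonneg) auto
  with eq nn[OF v(1)] v(2) have "F v = 1" "(\<Sum>u\<in>V - {v}. F u) = 0"
    by linarith+
  moreover from this(2) have "\<forall>u\<in>V - {v}. F u = 0"
    using nn fin by (subst (asm) sum_nonneg_eq_0_iff) auto
  ultimately show thesis
    using v that by blast
qed

text \<open>This replaces the \<open>GREATEST\<close> of the rank by a test at each vertex: an
  effective divisor of degree 1 is a single chip, and the degree of \<open>D\<close> bounds the
  admissible \<open>k\<close>, so the maximum is attained.\<close>

lemma positive_rank_iff:
  assumes "finite V" "V \<noteq> {}"
  shows "div_rank V E D > 0 \<longleftrightarrow>
    (\<forall>v\<in>V. \<exists>D'. effective V D' \<and> lin_equiv V E D D' \<and> D' v \<ge> 1)"
    (is "_ \<longleftrightarrow> ?R")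
proof -
  define P where "P k \<longleftrightarrow> (\<forall>F. effective V F \<and> div_degree V F = int k \<longrightarrow>
                 linear_system V E (\<lambda>v. D v - F v) \<noteq> {})" for k :: nat
  have rank: "div_rank V E D = (if linear_system V E D = {} then -1 else int (Greatest P))"
    by (simp add: div_rank_def P_def[abs_def])
  obtain q where q: "q \<in> V"
    using assms by blast
  \<comment> \<open>Test \<open>P k\<close> on the divisor with all \<open>k\<close> chips at
    \<open>v\<close>, then add these chips back.\<close>
  have concentrate: "\<exists>D'. effective V D' \<and> lin_equiv V E D D' \<and> D' v \<ge> int k"
    if "P k" "v \<in> V" for k v
  proof -
    let ?F = "\<lambda>u. if u = v then int k else 0"
    have "effective V ?F \<and> div_degree V ?F = int k"
      using assms \<open>v \<in> V\<close> by (auto simp: effective_def div_degree_indicator)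
    then have "linear_system V E (\<lambda>v. D v - ?F v) \<noteq> {}"
      using \<open>P k\<close> unfolding P_def by blast
    then obtain D' where D': "effective V D'" "lin_equiv V E D (\<lambda>u. D' u + ?F u)"
      by (auto simp: linear_system_def lin_equiv_diff_left_iff)
    then show ?thesis
      using \<open>v \<in> V\<close> by (intro exI[of _ "\<lambda>u. D' u + ?F u"]) (auto simp: effective_def)
  qed
  have bound: "k \<le> nat (div_degree V D)" if Pk: "P k" for k
  proof -
    obtain D' where D': "effective V D'" "lin_equiv V E D D'" "D' q \<ge> int k"
      using concentrate[OF Pk q] by blast
    have "D' q \<le> div_degree V D'"
      unfolding div_degree_def using D'(1) assms(1) by (intro member_le_sum[OF q]) (auto simp: effective_def)
    with D' lin_equiv_degree[OF D'(2)] show ?thesis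
      by linarith
  qed
  show ?thesis
  proof
    assume pos: "div_rank V E D > 0"
    then have ne: "linear_system V E D \<noteq> {}" and gr: "Greatest P > 0"
      by (auto simp: rank split: if_splits)
    \<comment> \<open>Some \<open>k\<close> must be admissible before \<open>Greatest P\<close> is
      known to satisfy \<open>P\<close>.\<close>
    have "P 0"
      unfolding P_def
    proof (intro allI impI)
      fix F assume F: "effective V F \<and> div_degree V F = int 0"
      then have "\<forall>v\<in>V. F v = 0"
        using assms sum_nonneg_eq_0_iff[of V F] by (simp add: effective_def div_degree_def)
      then show "linear_system V E (\<lambda>v. D v - F v) \<noteq> {}"
        using ne by (simp add: linear_system_def lin_equiv_def)
    qed
    then have PG: "P (Greatest P)"
      using bound by (intro GreatestI_nat[of P 0])
    show ?R
    proof
      fix v assume "v \<in> V"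
      then obtain D' where "effective V D'" "lin_equiv V E D D'" "D' v \<ge> int (Greatest P)"
        using concentrate[OF PG] by blast
      with gr show "\<exists>D'. effective V D' \<and> lin_equiv V E D D' \<and> D' v \<ge> 1"
        by (intro exI[of _ D']) auto
    qed
  next
    assume R: ?R
    have "P 1"
      unfolding P_def
    proof (intro allI impI)
      fix F assume "effective V F \<and> div_degree V F = int 1"
      then obtain v where v: "v \<in> V" "F v = 1" "\<And>u. u \<in> V \<Longrightarrow> u \<noteq> v \<Longrightarrow> F u = 0"
        using effective_degree_1_cases[of V F] by auto
      obtain D' where D': "effective V D'" "lin_equiv V E D D'" "D' v \<ge> 1"
        using R v by blast
      have "effective V (\<lambda>u. D' u - F u)"
        unfolding effective_def
      proof
        fix u assume "u \<in> V"
        then show "0 \<le> D' u - F u"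
          using v D' by (cases "u = v") (auto simp: effective_def)
      qed
      moreover have "lin_equiv V E (\<lambda>v. D v - F v) (\<lambda>u. D' u - F u)"
        using D' by (simp add: lin_equiv_diff_left_iff)
      ultimately show "linear_system V E (\<lambda>v. D v - F v) \<noteq> {}"
        by (auto simp: linear_system_def)
    qed
    then have "Greatest P \<ge> 1"
      using bound by (rule Greatest_le_nat)
    moreover have "linear_system V E D \<noteq> {}"
      using R q by (auto simp: linear_system_def)
    ultimately show "div_rank V E D > 0"
      by (simp add: rank)
  qed
qed

section \<open>Linear equivalence and gonality on stars\<close>

locale star_multigraph =
  fixes V :: "'v set" and E :: "'v set multiset" and v0 :: 'v
  assumes finite_V: "finite V"
    and centre: "v0 \<in> V"
    and leaf_edge: "v \<in> V - {v0} \<Longrightarrow> {v0, v} \<in># E"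
    and no_leaf_edge: "u \<in> V - {v0} \<Longrightarrow> v \<in> V - {v0} \<Longrightarrow> {u, v} \<notin># E"
begin

abbreviation leaves :: "'v set" where
  "leaves \<equiv> V - {v0}"

abbreviation mult :: "'v \<Rightarrow> nat" where
  "mult v \<equiv> count E {v0, v}"

lemma mult_pos: "v \<in> leaves \<Longrightarrow> mult v > 0"
  using leaf_edge by simp

lemma div_degree_split: "div_degree V D = D v0 + (\<Sum>v\<in>leaves. D v)"
  using finite_V centre by (simp add: div_degree_def sum.remove[of V v0])

lemma laplacian_leaf:
  assumes "v \<in> leaves"
  shows "laplacian V E f v = int (mult v) * (f v - f v0)"
proof -
  have "(\<Sum>w\<in>leaves. int (count E {v, w}) * (f v - f w)) = 0"
    using no_leaf_edge[OF assms] by (intro sum.neutral) (auto simp: not_in_iff)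
  then show ?thesis
    using finite_V centre by (simp add: laplacian_def sum.remove[of V v0] insert_commute)
qed

text \<open>A leaf only exchanges chips with the centre, in multiples of its multiplicity and
  independently of the other leaves. The centre is then determined by the degree.\<close>

lemma lin_equiv_iff:
  "lin_equiv V E D D' \<longleftrightarrow>
    div_degree V D = div_degree V D' \<and> (\<forall>v\<in>leaves. int (mult v) dvd D v - D' v)"
proof
  assume eq: "lin_equiv V E D D'"
  then obtain f where "\<forall>v\<in>V. D v - D' v = laplacian V E f v"
    by (auto simp: lin_equiv_def)
  then have "D v - D' v = int (mult v) * (f v - f v0)" if "v \<in> leaves" for v
    using that laplacian_leaf[OF that] by simp
  then show "div_degree V D = div_degree V D' \<and> (\<forall>v\<in>leaves. int (mult v) dvd D v - D' v)"
    using lin_equiv_degree[OF eq] by simp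
next
  assume R: "div_degree V D = div_degree V D' \<and> (\<forall>v\<in>leaves. int (mult v) dvd D v - D' v)"
  \<comment> \<open>Only differences \<open>f v - f v0\<close> matter, so \<open>f\<close> may
    vanish at the centre; each leaf equation is then solved by an exact division.\<close>
  define f where "f v = (if v = v0 then 0 else (D v - D' v) div int (mult v))" for v
  have leaf: "laplacian V E f v = D v - D' v" if "v \<in> leaves" for v
    using that R by (simp add: laplacian_leaf f_def)
  have "laplacian V E f v0 + (\<Sum>v\<in>leaves. D v - D' v) = (\<Sum>v\<in>V. laplacian V E f v)"
    using finite_V centre leaf by (simp add: sum.remove[of V v0])
  then have "laplacian V E f v0 = D v0 - D' v0"
    using R by (simp add: sum_laplacian_eq_0 sum_subtractf div_degree_split)
  with leaf show "lin_equiv V E D D'"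
    unfolding lin_equiv_def by (metis DiffI singletonD)
qed

lemma positive_rank_degree_ge:
  assumes "div_rank V E D > 0"
  obtains t where "t \<ge> 1" "div_degree V D \<ge> int (card {v\<in>leaves. mult v > t} + t)"
proof -
  define \<rho> where "\<rho> v = D v mod int (mult v)" for v
  define T where "T = div_degree V D - (\<Sum>v\<in>leaves. \<rho> v)"
  have fin: "finite leaves"
    using finite_V by simp
  have \<rho>_nonneg: "\<rho> v \<ge> 0" if "v \<in> leaves" for v
    using mult_pos[OF that] by (simp add: \<rho>_def)
  \<comment> \<open>For every effective representative, \<open>T\<close> is the content of the
    centre plus the excess of the leaves over their residues, all nonnegative.\<close>
  have reach: "\<exists>D'. effective V D' \<and> D' v \<ge> 1 \<and> (\<forall>u\<in>leaves. D' u \<ge> \<rho> u \<and> \<rho> u = D' u mod int (mult u)) \<and>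
      T = D' v0 + (\<Sum>u\<in>leaves. D' u - \<rho> u)" if v: "v \<in> V" for v
  proof -
    obtain D' where D': "effective V D'" "lin_equiv V E D D'" "D' v \<ge> 1"
      using positive_rank_iff[of V E D] finite_V centre assms v by blast
    have "\<rho> u = D' u mod int (mult u)" if "u \<in> leaves" for u
      using D'(2) that by (auto simp: lin_equiv_iff \<rho>_def mod_eq_dvd_iff)
    moreover have "D' u mod int (mult u) \<le> D' u" if "u \<in> leaves" for u
      using D'(1) that by (intro zmod_le_nonneg_dividend) (auto simp: effective_def)
    moreover have "T = D' v0 + (\<Sum>u\<in>leaves. D' u - \<rho> u)"
      using D'(2) unfolding T_def by (simp add: lin_equiv_iff div_degree_split sum_subtractf)
    ultimately show ?thesis
      using D' by auto
  qed
  have T1: "T \<ge> 1"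
  proof -
    obtain D' where D': "D' v0 \<ge> 1" "\<forall>u\<in>leaves. D' u \<ge> \<rho> u" "T = D' v0 + (\<Sum>u\<in>leaves. D' u - \<rho> u)"
      using reach[OF centre] by blast
    then have "(\<Sum>u\<in>leaves. D' u - \<rho> u) \<ge> 0"
      by (intro sum_nonneg) auto
    with D' show ?thesis by linarith
  qed
  \<comment> \<open>A leaf of residue 0 that holds a chip holds at least \<open>mult v\<close> of
    them, and all of these count towards \<open>T\<close>.\<close>
  have \<rho>_pos: "\<rho> v \<ge> 1" if v: "v \<in> leaves" and gt: "int (mult v) > T" for v
  proof (rule ccontr)
    assume "\<not> \<rho> v \<ge> 1"
    with \<rho>_nonneg[OF v] have 0: "\<rho> v = 0" by linarith
    obtain D' where D': "effective V D'" "D' v \<ge> 1" "\<forall>u\<in>leaves. D' u \<ge> \<rho> u"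
      "\<rho> v = D' v mod int (mult v)" "T = D' v0 + (\<Sum>u\<in>leaves. D' u - \<rho> u)"
      using reach[of v] v by blast
    have "int (mult v) \<le> D' v"
      using D' 0 by (intro zdvd_imp_le) auto
    also have "D' v - \<rho> v \<le> (\<Sum>u\<in>leaves. D' u - \<rho> u)"
      using D' fin by (intro member_le_sum[OF v]) auto
    then have "D' v \<le> T"
      using D' centre 0 by (auto simp: effective_def)
    finally show False
      using gt by simp
  qed
  have "int (card {v\<in>leaves. mult v > nat T}) = (\<Sum>v\<in>{v\<in>leaves. mult v > nat T}. 1)"
    by simp
  also have "\<dots> \<le> (\<Sum>v\<in>{v\<in>leaves. mult v > nat T}. \<rho> v)"
    using \<rho>_pos by (intro sum_mono) auto
  also have "\<dots> \<le> (\<Sum>v\<in>leaves. \<rho> v)"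
    using fin \<rho>_nonneg by (intro sum_mono2) auto
  finally have "div_degree V D \<ge> int (card {v\<in>leaves. mult v > nat T} + nat T)"
    using T1 by (simp add: T_def)
  then show thesis
    using T1 that[of "nat T"] by simp
qed

lemma positive_rank_exists:
  assumes "t \<ge> 1"
  shows "\<exists>D. div_rank V E D > 0 \<and> div_degree V D = int (card {v\<in>leaves. mult v > t} + t)"
proof -
  \<comment> \<open>The cheapest choice: only leaves that \<open>t\<close> chips at the centre
    cannot serve receive a chip of their own.\<close>
  define D where "D v = (if v = v0 then int t else if mult v > t then 1 else 0)" for v
  have "(\<Sum>v\<in>leaves. D v) = (\<Sum>v\<in>leaves. if mult v > t then 1 else 0)"
    by (intro sum.cong) (auto simp: D_def)
  also have "\<dots> = int (card {v\<in>leaves. mult v > t})"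
    using finite_V by (simp flip: sum.inter_filter)
  finally have deg: "div_degree V D = int (card {v\<in>leaves. mult v > t} + t)"
    by (simp add: div_degree_split D_def)
  have "\<exists>D'. effective V D' \<and> lin_equiv V E D D' \<and> D' v \<ge> 1" if v: "v \<in> V" for v
  proof (cases "v = v0 \<or> mult v > t")
    case True
    then have "effective V D" "lin_equiv V E D D" "D v \<ge> 1"
      using assms by (auto simp: effective_def D_def lin_equiv_iff)
    then show ?thesis by blast
  next
    case False
    then have leaf: "v \<in> leaves" and le: "mult v \<le> t"
      using v by auto
    \<comment> \<open>This is the result of firing every vertex except \<open>v\<close> once;
      \<open>le\<close> keeps the centre out of debt.\<close>
    define D' where "D' = D(v0 := int t - int (mult v), v := int (mult v))"
    have "(\<Sum>u\<in>leaves. D' u) = (\<Sum>u\<in>leaves. D u) + int (mult v)"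
      using leaf le finite_V False
      by (simp add: sum.remove[of leaves v] D'_def D_def)
    then have "div_degree V D' = div_degree V D"
      using leaf by (auto simp: div_degree_split D'_def D_def)
    then have "lin_equiv V E D D'"
      using leaf le by (auto simp: lin_equiv_iff D'_def D_def)
    moreover have "effective V D'"
      using le by (auto simp: effective_def D'_def D_def)
    moreover have "D' v \<ge> 1"
      using mult_pos[OF leaf] by (simp add: D'_def)
    ultimately show ?thesis by blast
  qed
  then have "div_rank V E D > 0"
    using positive_rank_iff[of V E D] finite_V centre by blast
  with deg show ?thesis by blast
qed

lemma gonality_attained:
  obtains t where "t \<ge> 1" "gonality V E \<ge> card {v\<in>leaves. mult v > t} + t"
proof -
  have "\<exists>d. \<exists>D. div_rank V E D > 0 \<and> div_degree V D = int d"
    using positive_rank_exists[of 1] by blast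
  then have "\<exists>D. div_rank V E D > 0 \<and> div_degree V D = int (gonality V E)"
    unfolding gonality_def by (rule LeastI_ex)
  then obtain D where "div_rank V E D > 0" and deg: "div_degree V D = int (gonality V E)"
    by blast
  then obtain t where "t \<ge> 1" "div_degree V D \<ge> int (card {v\<in>leaves. mult v > t} + t)"
    by (auto elim: positive_rank_degree_ge)
  then show thesis
    using that deg by (metis of_nat_le_iff)
qed

lemma gonality_le:
  assumes "t \<ge> 1"
  shows "gonality V E \<le> card {v\<in>leaves. mult v > t} + t"
  unfolding gonality_def using positive_rank_exists[OF assms] by (rule Least_le)

end

section \<open>Comparison of arbitrary thresholds \<open>t\<close> with the values
  \<open>a 1, ..., a k, 1\<close>\<close>

theorem theorem3p3:
  fixes V :: "'v set" and E :: "'v set multiset" and k :: nat and a r :: "nat \<Rightarrow> nat"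
  assumes "k \<ge> 1"
    and "\<forall>i\<in>{1..<k}. a i > a (Suc i)"
    and "a k \<ge> 1"
    and "banana_star V E k a r"
  shows "gonality V E =
    Min ((\<lambda>j. (\<Sum>i=1..j. r i) + (if j < k then a (Suc j) else 1)) ` {0..k})"
proof -
  obtain v0 where fin: "finite V" and v0: "v0 \<in> V"
    and edge: "\<forall>v\<in>V - {v0}. {v0, v} \<in># E"
    and nedge: "\<forall>u\<in>V - {v0}. \<forall>v\<in>V - {v0}. {u, v} \<notin># E"
    and ex: "\<forall>v\<in>V - {v0}. \<exists>i\<in>{1..k}. count E {v0, v} = a i"
    and r: "\<forall>i\<in>{1..k}. card {v\<in>V - {v0}. count E {v0, v} = a i} = r i"
    using assms(4) by (auto simp: banana_star_def multigraph_def)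
  interpret star_multigraph V E v0
    using fin v0 edge nedge by unfold_locales auto
  have anti: "a j < a i" if "1 \<le> i" "i < j" "j \<le> k" for i j
    using that(2,1,3)
  proof (induction rule: strict_inc_induct[of i j, consumes 1])
    case (base i)
    then show ?case using assms(2) by auto
  next
    case (step i)
    then have "a j < a (Suc i)" "a (Suc i) < a i" using assms(2) by auto
    then show ?case by simp
  qed
  have anti_le: "a j \<le> a i" if "1 \<le> i" "i \<le> j" "j \<le> k" for i j
    using anti[of i j] that by (cases "i = j") auto
  have prefix_sum: "(\<Sum>i=1..j. r i) = card {v\<in>leaves. \<exists>i\<in>{1..j}. mult v = a i}" if "j \<le> k" for j
  proof -
    have "{v\<in>leaves. \<exists>i\<in>{1..j}. mult v = a i} = (\<Union>i\<in>{1..j}. {v\<in>leaves. mult v = a i})"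
      by auto
    moreover have "card \<dots> = (\<Sum>i=1..j. card {v\<in>leaves. mult v = a i})"
    proof (intro card_UN_disjoint ballI impI)
      fix i i' assume "i \<in> {1..j}" "i' \<in> {1..j}" "i \<noteq> i'"
      then have "a i \<noteq> a i'"
        using anti[of i i'] anti[of i' i] that by (cases i i' rule: linorder_cases) auto
      then show "{v\<in>leaves. mult v = a i} \<inter> {v\<in>leaves. mult v = a i'} = {}"
        by auto
    qed (use fin in auto)
    ultimately show ?thesis
      using r that by simp
  qed
  \<comment> \<open>When \<open>t\<close> lies in the gap between \<open>a (Suc j)\<close> and
    \<open>a j\<close>, the leaves above it are exactly the first \<open>j\<close> classes. The
    conditional premises leave the gap open at \<open>j = 0\<close> and
    \<open>j = k\<close>.\<close>
  have prefix_gt: "(\<Sum>i=1..j. r i) = card {v\<in>leaves. mult v > t}"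
    if "j \<le> k" "j \<ge> 1 \<Longrightarrow> t < a j" "j < k \<Longrightarrow> a (Suc j) \<le> t" for j t
  proof -
    have "(\<exists>i\<in>{1..j}. mult v = a i) \<longleftrightarrow> mult v > t" if v: "v \<in> leaves" for v
    proof
      assume "\<exists>i\<in>{1..j}. mult v = a i"
      then obtain i where "i \<in> {1..j}" "mult v = a i" by blast
      then show "mult v > t"
        using anti_le[of i j] \<open>j \<le> k\<close> \<open>j \<ge> 1 \<Longrightarrow> t < a j\<close> by auto
    next
      assume gt: "mult v > t"
      obtain i where i: "i \<in> {1..k}" "mult v = a i"
        using ex v by blast
      have "i \<le> j"
        using anti_le[of "Suc j" i] i gt \<open>j < k \<Longrightarrow> a (Suc j) \<le> t\<close> by force
      with i show "\<exists>i\<in>{1..j}. mult v = a i" by auto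
    qed
    then have "{v\<in>leaves. \<exists>i\<in>{1..j}. mult v = a i} = {v\<in>leaves. mult v > t}"
      by blast
    with prefix_sum[OF \<open>j \<le> k\<close>] show ?thesis by simp
  qed
  let ?g = "\<lambda>j. (\<Sum>i=1..j. r i) + (if j < k then a (Suc j) else 1)"
  show ?thesis
  proof (rule antisym)
    have "gonality V E \<le> ?g j" if "j \<le> k" for j
    proof (cases "j < k")
      case True
      have "a (Suc j) \<ge> 1"
        using anti_le[of "Suc j" k] True assms(3) by simp
      moreover have "(\<Sum>i=1..j. r i) = card {v\<in>leaves. mult v > a (Suc j)}"
        using True anti[of j "Suc j"] by (intro prefix_gt) auto
      ultimately show ?thesis
        using gonality_le[of "a (Suc j)"] True by simp
    next
      case False
      \<comment> \<open>For \<open>j = k\<close> the threshold is 1. Since \<open>a k\<close> may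
        itself be 1, the inclusion can be proper, but an upper bound suffices.\<close>
      have "{v\<in>leaves. mult v > 1} \<subseteq> {v\<in>leaves. \<exists>i\<in>{1..k}. mult v = a i}"
        using ex by blast
      then have "card {v\<in>leaves. mult v > 1} \<le> (\<Sum>i=1..k. r i)"
        using fin by (subst prefix_sum) (auto intro: card_mono)
      then show ?thesis
        using gonality_le[of 1] False that by simp
    qed
    then show "gonality V E \<le> Min (?g ` {0..k})"
      by simp
  next
    obtain t where t: "t \<ge> 1" "gonality V E \<ge> card {v\<in>leaves. mult v > t} + t"
      by (rule gonality_attained)
    \<comment> \<open>This finds the gap containing \<open>t\<close>: minimality gives
      \<open>t < a j\<close> when \<open>j \<ge> 1\<close>, and the alternative \<open>j = k\<close>
      covers \<open>t\<close> below all values.\<close>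
    define j where "j = (LEAST j. j = k \<or> a (Suc j) \<le> t)"
    have j: "j = k \<or> a (Suc j) \<le> t"
      unfolding j_def by (rule LeastI[of _ k]) simp
    have "j \<le> k"
      unfolding j_def by (rule Least_le) simp
    have "t < a j" if "j \<ge> 1"
      using not_less_Least[of "j - 1" "\<lambda>j. j = k \<or> a (Suc j) \<le> t"] that
      by (simp flip: j_def)
    then have "(\<Sum>i=1..j. r i) = card {v\<in>leaves. mult v > t}"
      using j \<open>j \<le> k\<close> by (intro prefix_gt) auto
    \<comment> \<open>Lowering \<open>t\<close> to the bottom of its gap, \<open>a (Suc j)\<close>
      or 1, keeps the leaf count and does not increase the total.\<close>
    then have "?g j \<le> gonality V E"
      using j t by auto
    moreover have "Min (?g ` {0..k}) \<le> ?g j"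
      using \<open>j \<le> k\<close> by (intro Min_le) auto
    ultimately show "Min (?g ` {0..k}) \<le> gonality V E"
      by linarith
  qed
qed

end
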